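(* $st$-Short Secluded Path can be solved in $O((k+\ell)^{k})\cdot n^{O(1)}$ time, where $n$ is the number of vertices of the input graph; hence it is fixed-parameter tractable when parameterized by $k+\ell$.
   Context: All graphs are finite, simple and undirected. For a graph $G=(V,E)$ and $W\subseteq V$, the open neighborhood of $W$ is $N_G(W)=\{v\in V\setminus W : \exists w\in W,\ \{v,w\}\in E\}$. $st$-Short Secluded Path: given an undirected graph $G$, two distinct vertices $s,t$ of $G$, and integers $k\ge 2$, $\ell\ge 0$, decide whether there is a simple path $P$ in $G$ with endpoints $s$ and $t$ such that $|V(P)|\le k$ and $|N_G(V(P))|\le\ell$. A parameterized problem is fixed-parameter tractable with respect to $p$ if every instance $x$ can be decided in $g(p)\cdot|x|^{O(1)}$ time for some computable $g$. *)

theory Defs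
  imports Main "HOL-Library.Log_Nat"
begin

section \<open>Graphs and the decision problem\<close>

definition simple_graph :: "'a set \<Rightarrow> 'a set set \<Rightarrow> bool" where
  "simple_graph V E \<longleftrightarrow> finite V \<and> (\<forall>e\<in>E. e \<subseteq> V \<and> card e = 2)"

definition open_nbhd :: "'a set \<Rightarrow> 'a set set \<Rightarrow> 'a set \<Rightarrow> 'a set" where
  "open_nbhd V E W = {v \<in> V - W. \<exists>w\<in>W. {v, w} \<in> E}"

text \<open>A simple path is represented by the sequence of its vertices, listed from \<open>s\<close> to \<open>t\<close>.\<close>

definition simple_path :: "'a set \<Rightarrow> 'a set set \<Rightarrow> 'a \<Rightarrow> 'a \<Rightarrow> 'a list \<Rightarrow> bool" where
  "simple_path V E s t p \<longleftrightarrow>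
     p \<noteq> [] \<and> set p \<subseteq> V \<and> distinct p \<and> successively (\<lambda>u v. {u, v} \<in> E) p \<and>
     hd p = s \<and> last p = t"

definition has_short_secluded_path ::
  "'a set \<Rightarrow> 'a set set \<Rightarrow> 'a \<Rightarrow> 'a \<Rightarrow> nat \<Rightarrow> nat \<Rightarrow> bool" where
  "has_short_secluded_path V E s t k l \<longleftrightarrow>
     (\<exists>p. simple_path V E s t p \<and> card (set p) \<le> k \<and> card (open_nbhd V E (set p)) \<le> l)"

text \<open>As inputs of an algorithm, graphs with \<open>n\<close> vertices have vertex set \<open>{..<n}\<close>.\<close>

record ssp_instance =
  order :: nat
  edges :: "nat set set"
  source :: nat
  target :: nat
  len_bound :: nat
  nbhd_bound :: nat

definition ssp_instances :: "ssp_instance set" where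
  "ssp_instances = {x. simple_graph {..<order x} (edges x) \<and>
     source x < order x \<and> target x < order x \<and> source x \<noteq> target x \<and> len_bound x \<ge> 2}"

definition ssp_yes :: "ssp_instance \<Rightarrow> bool" where
  "ssp_yes x \<longleftrightarrow> has_short_secluded_path {..<order x} (edges x)
     (source x) (target x) (len_bound x) (nbhd_bound x)"

text \<open>The graph is given by its adjacency matrix, row by row.\<close>

definition ssp_encode :: "ssp_instance \<Rightarrow> nat list" where
  "ssp_encode x =
     [order x, source x, target x, len_bound x, nbhd_bound x] @
     concat (map (\<lambda>u. map (\<lambda>v. if {u, v} \<in> edges x then 1 else 0) [0..<order x]) [0..<order x])"


section \<open>Random access machines\<close>

text \<open>
  Programs for a unit-cost random access machine, written with structured control flow. A state
  consists of registers and an indirectly addressable memory, all holding natural numbers. As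
  usual for the unit-cost measure, multiplication is not primitive (otherwise polynomial time
  would be too powerful). A program mentions only finitely many registers and constants.
  Subtraction is truncated at \<open>0\<close>.
\<close>

datatype com =
    Skip
  | Const nat nat      \<comment> \<open>\<open>Const i c\<close>: \<open>R\<^sub>i := c\<close>\<close>
  | Add nat nat nat    \<comment> \<open>\<open>Add i j k\<close>: \<open>R\<^sub>i := R\<^sub>j + R\<^sub>k\<close>\<close>
  | Sub nat nat nat    \<comment> \<open>\<open>Sub i j k\<close>: \<open>R\<^sub>i := R\<^sub>j - R\<^sub>k\<close>\<close>
  | Load nat nat       \<comment> \<open>\<open>Load i j\<close>: \<open>R\<^sub>i := M[R\<^sub>j]\<close>\<close>
  | Store nat nat      \<comment> \<open>\<open>Store i j\<close>: \<open>M[R\<^sub>i] := R\<^sub>j\<close>\<close>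
  | Seq com com
  | If nat com com     \<comment> \<open>tests \<open>R\<^sub>i \<noteq> 0\<close>\<close>
  | While nat com      \<comment> \<open>tests \<open>R\<^sub>i \<noteq> 0\<close>\<close>

type_synonym state = "(nat \<Rightarrow> nat) \<times> (nat \<Rightarrow> nat)"

text \<open>\<open>exec c \<sigma> t \<sigma>'\<close>: started in \<open>\<sigma>\<close>, the program \<open>c\<close> halts in \<open>\<sigma>'\<close> after exactly \<open>t\<close> steps.\<close>

inductive exec :: "com \<Rightarrow> state \<Rightarrow> nat \<Rightarrow> state \<Rightarrow> bool" where
  Skip: "exec Skip \<sigma> 1 \<sigma>"
| Const: "exec (Const i c) (r, m) 1 (r(i := c), m)"
| Add: "exec (Add i j k) (r, m) 1 (r(i := r j + r k), m)"
| Sub: "exec (Sub i j k) (r, m) 1 (r(i := r j - r k), m)"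
| Load: "exec (Load i j) (r, m) 1 (r(i := m (r j)), m)"
| Store: "exec (Store i j) (r, m) 1 (r, m(r i := r j))"
| Seq: "exec c\<^sub>1 \<sigma> t\<^sub>1 \<sigma>' \<Longrightarrow> exec c\<^sub>2 \<sigma>' t\<^sub>2 \<sigma>'' \<Longrightarrow> exec (Seq c\<^sub>1 c\<^sub>2) \<sigma> (t\<^sub>1 + t\<^sub>2) \<sigma>''"
| IfTrue: "fst \<sigma> i \<noteq> 0 \<Longrightarrow> exec c\<^sub>1 \<sigma> t \<sigma>' \<Longrightarrow> exec (If i c\<^sub>1 c\<^sub>2) \<sigma> (t + 1) \<sigma>'"
| IfFalse: "fst \<sigma> i = 0 \<Longrightarrow> exec c\<^sub>2 \<sigma> t \<sigma>' \<Longrightarrow> exec (If i c\<^sub>1 c\<^sub>2) \<sigma> (t + 1) \<sigma>'"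
| WhileFalse: "fst \<sigma> i = 0 \<Longrightarrow> exec (While i c) \<sigma> 1 \<sigma>"
| WhileTrue: "fst \<sigma> i \<noteq> 0 \<Longrightarrow> exec c \<sigma> t\<^sub>1 \<sigma>' \<Longrightarrow> exec (While i c) \<sigma>' t\<^sub>2 \<sigma>'' \<Longrightarrow>
    exec (While i c) \<sigma> (t\<^sub>1 + t\<^sub>2 + 1) \<sigma>''"

inductive_cases exec_SkipE: "exec Skip \<sigma> t \<sigma>'"
inductive_cases exec_ConstE: "exec (Const i c) \<sigma> t \<sigma>'"
inductive_cases exec_AddE: "exec (Add i j k) \<sigma> t \<sigma>'"
inductive_cases exec_SubE: "exec (Sub i j k) \<sigma> t \<sigma>'"
inductive_cases exec_LoadE: "exec (Load i j) \<sigma> t \<sigma>'"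
inductive_cases exec_StoreE: "exec (Store i j) \<sigma> t \<sigma>'"
inductive_cases exec_SeqE: "exec (Seq c\<^sub>1 c\<^sub>2) \<sigma> t \<sigma>'"
inductive_cases exec_IfE: "exec (If i c\<^sub>1 c\<^sub>2) \<sigma> t \<sigma>'"
inductive_cases exec_WhileE: "exec (While i c) \<sigma> t \<sigma>'"

lemma exec_deterministic:
  "exec c \<sigma> t \<sigma>' \<Longrightarrow> exec c \<sigma> u \<tau> \<Longrightarrow> t = u \<and> \<sigma>' = \<tau>"
proof (induction arbitrary: u \<tau> rule: exec.induct)
  case (Seq c\<^sub>1 \<sigma> t\<^sub>1 \<sigma>' c\<^sub>2 t\<^sub>2 \<sigma>'')
  from Seq.prems show ?case
    by (rule exec_SeqE) (metis Seq.IH)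
next
  case (IfTrue \<sigma> i c\<^sub>1 t \<sigma>' c\<^sub>2)
  from IfTrue.prems show ?case
    by (rule exec_IfE) (use IfTrue.hyps in simp_all, metis IfTrue.IH)
next
  case (IfFalse \<sigma> i c\<^sub>2 t \<sigma>' c\<^sub>1)
  from IfFalse.prems show ?case
    by (rule exec_IfE) (use IfFalse.hyps in simp_all, metis IfFalse.IH)
next
  case (WhileTrue \<sigma> i c t\<^sub>1 \<sigma>' t\<^sub>2 \<sigma>'')
  from WhileTrue.prems show ?case
    by (rule exec_WhileE) (use WhileTrue.hyps in simp_all, metis WhileTrue.IH)
qed (erule exec_SkipE exec_ConstE exec_AddE exec_SubE exec_LoadE exec_StoreE exec_WhileE; simp)+

text \<open>The input is stored in the memory from address \<open>0\<close> on, its length in register \<open>0\<close>.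
  The output is the final value of register \<open>0\<close>.\<close>

definition input_state :: "nat list \<Rightarrow> state" where
  "input_state w = ((\<lambda>_. 0)(0 := length w), (\<lambda>i. if i < length w then w ! i else 0))"

definition outputs_within :: "com \<Rightarrow> nat list \<Rightarrow> nat \<Rightarrow> nat \<Rightarrow> bool" where
  "outputs_within p w y b \<longleftrightarrow> (\<exists>t \<le> b. \<exists>\<sigma>. exec p (input_state w) t \<sigma> \<and> fst \<sigma> 0 = y)"

definition decides_within :: "com \<Rightarrow> nat list \<Rightarrow> bool \<Rightarrow> nat \<Rightarrow> bool" where
  "decides_within p w Q b \<longleftrightarrow> outputs_within p w (if Q then 1 else 0) b"

definition computable :: "(nat \<Rightarrow> nat) \<Rightarrow> bool" where
  "computable g \<longleftrightarrow> (\<exists>p. \<forall>x. \<exists>b. outputs_within p [x] (g x) b)"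


section \<open>Fixed-parameter tractability\<close>

text \<open>The size of an input is its length in bits, including one bit per number as a separator.\<close>

definition input_size :: "nat list \<Rightarrow> nat" where
  "input_size w = (\<Sum>a\<leftarrow>w. floorlog 2 a + 1)"

text \<open>A parameterized problem consists of a set \<open>X\<close> of instances, their encoding \<open>enc\<close>,
  the predicate \<open>yes\<close> that is to be decided, and the parameter \<open>\<kappa>\<close>.\<close>

definition fixed_parameter_tractable ::
  "'x set \<Rightarrow> ('x \<Rightarrow> nat list) \<Rightarrow> ('x \<Rightarrow> bool) \<Rightarrow> ('x \<Rightarrow> nat) \<Rightarrow> bool" where
  "fixed_parameter_tractable X enc yes \<kappa> \<longleftrightarrow>
     (\<exists>p g c. computable g \<and>
        (\<forall>x\<in>X. decides_within p (enc x) (yes x) (g (\<kappa> x) * input_size (enc x) ^ c)))"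

end

theory Submission
  imports Defs
begin

text \<open>
  A simple path from \<open>s\<close> to \<open>t\<close> with at most \<open>k\<close> vertices and at most \<open>l\<close> neighbours contains only
  vertices of degree less than \<open>k + l\<close>, since all neighbours of such a vertex lie on the path or in
  its neighbourhood. So a search tree of partial paths that is not expanded at vertices of larger
  degree has branching \<open>d = k + l - 1\<close> and depth at most \<open>k - 1\<close>, hence at most \<open>(d + 1) ^ (k - 1)\<close>
  nodes. The tree is traversed breadth first, the queue being kept in the memory behind the input;
  a node is processed in time \<open>O(n\<^sup>2)\<close>.
\<close>

section \<open>Weakest preconditions with running times\<close>

text \<open>Since \<open>exec\<close> is deterministic, asking for some run is the same as asking
  about the only one; termination and the exact running time are included.\<close>

definition wp :: "com \<Rightarrow> (nat \<Rightarrow> nat) \<Rightarrow> (nat \<Rightarrow> nat) \<Rightarrow>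
    (nat \<Rightarrow> (nat \<Rightarrow> nat) \<Rightarrow> (nat \<Rightarrow> nat) \<Rightarrow> bool) \<Rightarrow> bool" where
  "wp c r m Q \<longleftrightarrow> (\<exists>t r' m'. exec c (r, m) t (r', m') \<and> Q t r' m')"

lemma wp_mono:
  assumes "wp c r m Q" and "\<And>t r' m'. Q t r' m' \<Longrightarrow> Q' t r' m'"
  shows "wp c r m Q'"
  using assms unfolding wp_def by blast

lemma wp_basic [simp]:
  "wp Skip r m Q \<longleftrightarrow> Q 1 r m"
  "wp (Const i c) r m Q \<longleftrightarrow> Q 1 (r(i := c)) m"
  "wp (Add i j k) r m Q \<longleftrightarrow> Q 1 (r(i := r j + r k)) m"
  "wp (Sub i j k) r m Q \<longleftrightarrow> Q 1 (r(i := r j - r k)) m"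
  "wp (Load i j) r m Q \<longleftrightarrow> Q 1 (r(i := m (r j))) m"
  "wp (Store i j) r m Q \<longleftrightarrow> Q 1 r (m(r i := r j))"
  unfolding wp_def
  by (auto simp del: One_nat_def intro: exec.intros
      elim!: exec_SkipE exec_ConstE exec_AddE exec_SubE exec_LoadE exec_StoreE) simp_all

lemma wp_Seq [simp]:
  "wp (Seq c1 c2) r m Q \<longleftrightarrow> wp c1 r m (\<lambda>t1 r1 m1. wp c2 r1 m1 (\<lambda>t2. Q (t1 + t2)))"
  unfolding wp_def by (auto elim!: exec_SeqE) (metis, metis exec.Seq)

lemma wp_If [simp]:
  "wp (If i c1 c2) r m Q \<longleftrightarrow>
     (if r i \<noteq> 0 then wp c1 r m (\<lambda>t. Q (t + 1)) else wp c2 r m (\<lambda>t. Q (t + 1)))"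
  unfolding wp_def by (force intro: exec.intros elim: exec_IfE)

lemma wp_While_False: "r i = 0 \<Longrightarrow> wp (While i c) r m Q \<longleftrightarrow> Q 1 r m"
  unfolding wp_def by (force intro: exec.intros elim: exec_WhileE)

lemma wp_While_True:
  assumes "r i \<noteq> 0"
    and "wp c r m (\<lambda>t1 r1 m1. wp (While i c) r1 m1 (\<lambda>t2. Q (t1 + t2 + 1)))"
  shows "wp (While i c) r m Q"
  using assms unfolding wp_def by (metis exec.WhileTrue fst_conv)

text \<open>The index \<open>z\<close> is a potential that drops in every round, so it bounds the
  number of rounds; each costs at most \<open>T\<close> plus one guard test. Drops by more than one
  are allowed, so the weight of a search tree can be used directly.\<close>

lemma wp_While:
  assumes step: "\<And>z r m. I z r m \<Longrightarrow> r i \<noteq> 0 \<Longrightarrow>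
      wp c r m (\<lambda>t r' m'. t \<le> T \<and> (\<exists>z'<z. I z' r' m'))"
    and I: "I z r m"
  shows "wp (While i c) r m (\<lambda>t r' m'. t \<le> z * (T + 1) + 1 \<and> r' i = 0 \<and> (\<exists>z'. I z' r' m'))"
  using I
proof (induction z arbitrary: r m rule: less_induct)
  case (less z)
  show ?case
  proof (cases "r i = 0")
    case True
    with less.prems show ?thesis by (auto simp: wp_While_False)
  next
    case False
    show ?thesis
    proof (rule wp_While_True, rule False, rule wp_mono[OF step[OF less.prems False]], clarify)
      fix t r' m' z'
      assume t: "t \<le> T" and z': "z' < z" and I': "I z' r' m'"
      have "Suc z' * (T + 1) \<le> z * (T + 1)"
        using z' by (intro mult_right_mono) auto
      then show "wp (While i c) r' m' (\<lambda>t2 r'' m''. t + t2 + 1 \<le> z * (T + 1) + 1 \<and> r'' i = 0 \<and>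
          (\<exists>z'. I z' r'' m''))"
        using t by (intro wp_mono[OF less.IH[OF z' I']]) auto
    qed
  qed
qed

notation Seq (infixr \<open>;;\<close> 60)

text \<open>
  Register 2 holds the constant \<open>1\<close> in all programs below. \<open>g\<close> is a scratch register for the guard.
\<close>

definition For :: "nat \<Rightarrow> nat \<Rightarrow> nat \<Rightarrow> com \<Rightarrow> com" where
  "For i g n c = Const i 0 ;; Sub g n i ;; While g (c ;; Add i i 2 ;; Sub g n i)"

text \<open>A round costs the body, the increment, the new guard value and the test, hence
  \<open>T + 3\<close>; the extra 3 are two initialisations and the last test. The step asks for
  \<open>I\<close> with \<open>i\<close> and \<open>g\<close> already advanced, so proofs about
  bodies need not treat the guard.\<close>

lemma wp_For:
  assumes regs: "r n = N" "r 2 = 1" "distinct [i, g, n, 2]"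
    and start: "I 0 (r(i := 0, g := N)) m"
    and step: "\<And>x r m. x < N \<Longrightarrow> I x r m \<Longrightarrow> r i = x \<Longrightarrow> r n = N \<Longrightarrow> r 2 = 1 \<Longrightarrow>
      wp c r m (\<lambda>t r' m'. t \<le> T \<and> r' i = x \<and> r' n = N \<and> r' 2 = 1 \<and>
        I (Suc x) (r'(i := Suc x, g := N - Suc x)) m')"
  shows "wp (For i g n c) r m (\<lambda>t r' m'. t \<le> N * (T + 3) + 3 \<and> I N r' m')"
proof -
  \<comment> \<open>\<open>z\<close> counts the remaining rounds, which turns the upward counter
    into the falling potential that \<open>wp_While\<close> expects.\<close>
  define J where "J z r m \<longleftrightarrow> z \<le> N \<and> r i = N - z \<and> r g = z \<and> r n = N \<and> r 2 = 1 \<and> I (N - z) r m"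
    for z r m
  have "wp (While g (c ;; Add i i 2 ;; Sub g n i)) (r(i := 0, g := N)) m
     (\<lambda>t r' m'. t \<le> N * ((T + 2) + 1) + 1 \<and> r' g = 0 \<and> (\<exists>z'. J z' r' m'))"
  proof (rule wp_While)
    show "J N (r(i := 0, g := N)) m"
      using regs start by (auto simp: J_def)
  next
    fix z r m
    assume J: "J z r m" and nz: "r g \<noteq> 0"
    from J nz have z: "N - z < N" "I (N - z) r m" "r i = N - z" "r n = N" "r 2 = 1"
      "z - 1 < z" "z - 1 \<le> N" "Suc (N - z) = N - (z - 1)" "N - Suc (N - z) = z - 1"
      unfolding J_def by (blast | linarith)+
    have "wp (Seq c (Seq (Add i i 2) (Sub g n i))) r m (\<lambda>t r' m'. t \<le> T + 2 \<and> J (z - 1) r' m')"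
      unfolding wp_Seq wp_basic
    proof (rule wp_mono[OF step[OF z(1-5)]], elim conjE)
      fix t r' m'
      assume r': "t \<le> T" "r' i = N - z" "r' n = N" "r' 2 = 1"
        "I (Suc (N - z)) (r'(i := Suc (N - z), g := N - Suc (N - z))) m'"
      let ?r = "r'(i := r' i + r' 2)"
      have upd: "?r(g := ?r n - ?r i) = r'(i := Suc (N - z), g := N - Suc (N - z))"
        using r' regs by simp
      show "t + (1 + 1) \<le> T + 2 \<and> J (z - 1) (?r(g := ?r n - ?r i)) m'"
        unfolding upd J_def using r' regs z by simp
    qed
    then show "wp (Seq c (Seq (Add i i 2) (Sub g n i))) r m
        (\<lambda>t r' m'. t \<le> T + 2 \<and> (\<exists>z'<z. J z' r' m'))"
      by (rule wp_mono) (use z(6) in blast)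
  qed
  then have *: "wp (While g (Seq c (Seq (Add i i 2) (Sub g n i)))) (r(i := 0, g := N)) m
     (\<lambda>t r' m'. 1 + (1 + t) \<le> N * (T + 3) + 3 \<and> I N r' m')"
    by (rule wp_mono) (auto simp: J_def algebra_simps)
  have upd: "(r(i := 0))(g := (r(i := 0)) n - (r(i := 0)) i) = r(i := 0, g := N)"
    using regs by simp
  show ?thesis
    unfolding For_def wp_Seq wp_basic upd by (rule *)
qed

section \<open>Processing a node of the search tree\<close>

text \<open>
  Global registers: 3 is \<open>n\<close>, 4 is \<open>t\<close>, 5 is \<open>k + l\<close>, 6 is \<open>l\<close>, 7 and 8 are the head and the tail of the
  queue, 22 is the answer. For the current node, 9 is the endpoint \<open>v\<close>, 10 the remaining length \<open>j\<close>,
  11 the address of the adjacency row of \<open>v\<close>, 12 the size of the neighbourhood and 13 the degree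
  of \<open>v\<close>. The other registers are local.
\<close>

definition row_prog :: com where
  "row_prog = Const 11 5 ;; For 14 15 9 (Add 11 11 3)"

text \<open>Repeated addition replaces the missing multiplication. The matrix starts behind the five
  header numbers of \<open>ssp_encode\<close>, hence the offset 5.\<close>

lemma wp_row:
  assumes "r 2 = 1" "r 3 = n" "r 9 = v"
  shows "wp row_prog r m (\<lambda>t r' m'. t \<le> v * 4 + 4 \<and> m' = m \<and> r' 11 = 5 + v * n \<and>
     (\<forall>i. i \<notin> {11, 14, 15} \<longrightarrow> r' i = r i))"
proof -
  have "wp (For 14 15 9 (Add 11 11 3)) (r(11 := 5)) m
     (\<lambda>t r' m'. t \<le> v * (1 + 3) + 3 \<and>
        (m' = m \<and> r' 11 = 5 + v * n \<and> (\<forall>i. i \<notin> {11, 14, 15} \<longrightarrow> r' i = r i)))"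
    by (rule wp_For[where I = "\<lambda>x r' m'. m' = m \<and> r' 11 = 5 + x * n \<and>
          (\<forall>i. i \<notin> {11, 14, 15} \<longrightarrow> r' i = r i)"]) (use assms in auto)
  then show ?thesis
    unfolding row_prog_def by simp (erule wp_mono, auto)
qed

section \<open>Counting neighbours in the adjacency matrix\<close>

definition graph_mem :: "(nat \<Rightarrow> nat) \<Rightarrow> nat \<Rightarrow> nat set set \<Rightarrow> bool" where
  "graph_mem m n E \<longleftrightarrow> (\<forall>u<n. \<forall>v<n. m (5 + u * n + v) = of_bool ({u, v} \<in> E))"

definition flags :: "(nat \<Rightarrow> nat) \<Rightarrow> nat \<Rightarrow> nat \<Rightarrow> nat set \<Rightarrow> bool" where
  "flags m n a S \<longleftrightarrow> (\<forall>w<n. m (a + w) = of_bool (w \<in> S))"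

lemma card_less_Suc_Collect:
  "card {w. w < Suc x \<and> P w} = card {w. w < x \<and> P w} + of_bool (P x)"
proof -
  have "{w. w < Suc x \<and> P w} = (if P x then insert x {w. w < x \<and> P w} else {w. w < x \<and> P w})"
    by (auto simp: less_Suc_eq)
  then show ?thesis by auto
qed

text \<open>Register 19 runs down a column of the matrix in strides of \<open>n\<close>, so no
  address requires a product.\<close>

definition touched_prog :: com where
  "touched_prog = Const 18 0 ;; Const 20 5 ;; Add 19 20 14 ;;
     For 16 17 3 (Add 20 7 16 ;; Load 20 20 ;; Load 21 19 ;; Add 19 19 3 ;;
        If 20 (If 21 (Const 18 1) Skip) Skip)"

lemma wp_touched:
  assumes "r 2 = 1" "r 3 = n" "r 14 = w" "w < n" and g: "graph_mem m n E" and f: "flags m n (r 7) S"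
  shows "wp touched_prog r m (\<lambda>t r' m'. t \<le> n * 10 + 6 \<and> m' = m \<and>
     r' 18 = of_bool (\<exists>u<n. u \<in> S \<and> {u, w} \<in> E) \<and>
     (\<forall>i. i \<notin> {16, 17, 18, 19, 20, 21} \<longrightarrow> r' i = r i))"
proof -
  define I where "I x r' m' \<longleftrightarrow> m' = m \<and> r' 19 = 5 + x * n + w \<and>
      r' 18 = of_bool (\<exists>u<x. u \<in> S \<and> {u, w} \<in> E) \<and>
      (\<forall>i. i \<notin> {16, 17, 18, 19, 20, 21} \<longrightarrow> r' i = r i)" for x :: nat and r' m' :: "nat \<Rightarrow> nat"
  have "wp (For 16 17 3 (Add 20 7 16 ;; Load 20 20 ;; Load 21 19 ;; Add 19 19 3 ;;
        If 20 (If 21 (Const 18 1) Skip) Skip)) (r(18 := 0, 20 := 5, 19 := 5 + w)) m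
     (\<lambda>t r' m'. t \<le> n * (7 + 3) + 3 \<and> I n r' m')"
  proof (rule wp_For)
    fix x and r1 m1 :: "nat \<Rightarrow> nat"
    assume x: "x < n" "I x r1 m1" "r1 16 = x" "r1 3 = n" "r1 2 = 1"
    then have m1: "m1 = m" "m (r 7 + x) = of_bool (x \<in> S)"
        "m (5 + x * n + w) = of_bool ({x, w} \<in> E)"
        "r1 7 = r 7" "r1 19 = 5 + x * n + w"
      using g f \<open>w < n\<close> by (auto simp: graph_mem_def flags_def I_def)
    with x show "wp (Add 20 7 16 ;; Load 20 20 ;; Load 21 19 ;; Add 19 19 3 ;;
        If 20 (If 21 (Const 18 1) Skip) Skip) r1 m1
        (\<lambda>t r' m'. t \<le> 7 \<and> r' 16 = x \<and> r' 3 = n \<and> r' 2 = 1 \<and>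
          I (Suc x) (r'(16 := Suc x, 17 := n - Suc x)) m')"
      by (simp add: I_def less_Suc_eq) auto
  qed (use assms in \<open>auto simp: I_def\<close>)
  from this show ?thesis
    unfolding touched_prog_def I_def by (simp add: assms split del: split_of_bool) (erule wp_mono, auto)
qed

definition count_prog :: com where
  "count_prog = For 14 15 3 (
     Add 20 11 14 ;; Load 20 20 ;; Add 13 13 20 ;; Add 20 7 14 ;; Load 20 20 ;;
     If 20 Skip (touched_prog ;; Add 12 12 18))"

text \<open>One pass yields both numbers: the entries in the row of \<open>v\<close> add up to its
  degree, and each vertex outside \<open>S\<close> is tested for a neighbour in \<open>S\<close> by
  a linear scan, which makes the pass quadratic.\<close>

lemma wp_count:
  assumes "r 2 = 1" "r 3 = n" "r 11 = 5 + v * n" "v < n" "r 12 = 0" "r 13 = 0"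
    and g: "graph_mem m n E" and f: "flags m n (r 7) S"
  shows "wp count_prog r m (\<lambda>t r' m'. t \<le> n * (n * 10 + 20) + 3 \<and> m' = m \<and>
     r' 12 = card {w. w < n \<and> w \<notin> S \<and> (\<exists>u<n. u \<in> S \<and> {u, w} \<in> E)} \<and>
     r' 13 = card {w. w < n \<and> {v, w} \<in> E} \<and>
     (\<forall>i. i \<notin> {12, 13, 14, 15, 16, 17, 18, 19, 20, 21} \<longrightarrow> r' i = r i))"
proof -
  define I where "I x r' m' \<longleftrightarrow> m' = m \<and>
     r' 12 = card {w. w < x \<and> w \<notin> S \<and> (\<exists>u<n. u \<in> S \<and> {u, w} \<in> E)} \<and>
     r' 13 = card {w. w < x \<and> {v, w} \<in> E} \<and>
     (\<forall>i. i \<notin> {12, 13, 14, 15, 16, 17, 18, 19, 20, 21} \<longrightarrow> r' i = r i)"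
    for x :: nat and r' m' :: "nat \<Rightarrow> nat"
  have "wp count_prog r m (\<lambda>t r' m'. t \<le> n * ((n * 10 + 17) + 3) + 3 \<and> I n r' m')"
    unfolding count_prog_def
  proof (rule wp_For)
    fix x and r1 m1 :: "nat \<Rightarrow> nat"
    assume x: "x < n" "I x r1 m1" "r1 14 = x" "r1 3 = n" "r1 2 = 1"
    then have m1: "m1 = m" "m (r 7 + x) = of_bool (x \<in> S)"
        "m (5 + v * n + x) = of_bool ({v, x} \<in> E)"
        "r1 7 = r 7" "r1 11 = 5 + v * n"
      using assms by (auto simp: graph_mem_def flags_def I_def)
    let ?r = "r1(20 := m (r 7 + x), 13 := r1 13 + m (5 + v * n + x))"
    have *: "wp touched_prog ?r m
     (\<lambda>t r' m'. t \<le> n * 10 + 6 \<and> m' = m \<and>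
         r' 18 = of_bool (\<exists>u<n. u \<in> S \<and> {u, x} \<in> E) \<and>
         (\<forall>i. i \<notin> {16, 17, 18, 19, 20, 21} \<longrightarrow> r' i = ?r i))"
      by (rule wp_touched) (use x m1 g f in auto)
    show "wp (Add 20 11 14 ;; Load 20 20 ;; Add 13 13 20 ;; Add 20 7 14 ;; Load 20 20 ;;
         If 20 Skip (touched_prog ;; Add 12 12 18)) r1 m1
        (\<lambda>t r' m'. t \<le> n * 10 + 17 \<and> r' 14 = x \<and> r' 3 = n \<and> r' 2 = 1 \<and>
          I (Suc x) (r'(14 := Suc x, 15 := n - Suc x)) m')"
    proof (cases "x \<in> S")
      case True
      then show ?thesis using x m1
        by (simp add: I_def card_less_Suc_Collect)
    next
      case False
      show ?thesis using x m1 False *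
        by (simp add: fun_upd_twist split del: split_of_bool)
          (erule wp_mono, auto simp: I_def card_less_Suc_Collect)
    qed
  qed (use assms in \<open>auto simp: I_def\<close>)
  then show ?thesis unfolding I_def by (rule wp_mono) (auto simp: algebra_simps)
qed

section \<open>The queue of nodes in memory\<close>

text \<open>
  A node \<open>(S, v, j)\<close> is a partial path with vertex set \<open>S\<close> and endpoint \<open>v\<close> that may be extended by
  at most \<open>j\<close> further vertices.
\<close>

type_synonym node = "nat set \<times> nat \<times> nat"

fun block :: "(nat \<Rightarrow> nat) \<Rightarrow> nat \<Rightarrow> nat \<Rightarrow> node \<Rightarrow> bool" where
  "block m n a (S, v, j) \<longleftrightarrow> flags m n a S \<and> m (a + n) = v \<and> m (Suc (a + n)) = j"

fun queue :: "(nat \<Rightarrow> nat) \<Rightarrow> nat \<Rightarrow> nat \<Rightarrow> node list \<Rightarrow> nat \<Rightarrow> bool" where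
  "queue m n a [] b \<longleftrightarrow> a = b"
| "queue m n a (x # xs) b \<longleftrightarrow> block m n a x \<and> queue m n (a + (n + 2)) xs b"

lemma block_cong:
  "block m n a x \<Longrightarrow> (\<And>i. i < a + (n + 2) \<Longrightarrow> m' i = m i) \<Longrightarrow> block m' n a x"
  by (cases x) (auto simp: flags_def)

lemma queue_le: "queue m n a xs b \<Longrightarrow> a \<le> b"
  by (induction xs arbitrary: a) force+

lemma queue_append: "queue m n a (xs @ ys) b \<longleftrightarrow> (\<exists>c. queue m n a xs c \<and> queue m n c ys b)"
  by (induction xs arbitrary: a) auto

text \<open>A frame rule: all blocks end at or before \<open>b\<close>, so appending from
  \<open>b\<close> on leaves the queue intact.\<close>

lemma queue_cong:
  assumes "queue m n a xs b" and "\<And>i. i < b \<Longrightarrow> m' i = m i"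
  shows "queue m' n a xs b"
  using assms(1)
proof (induction xs arbitrary: a)
  case (Cons x xs)
  then have "a + (n + 2) \<le> b" by (auto dest: queue_le)
  then have "\<And>i. i < a + (n + 2) \<Longrightarrow> m' i = m i" using assms(2) by simp
  with Cons show ?case by (auto intro: block_cong)
qed simp

definition push_prog :: com where
  "push_prog = For 16 17 3 (Add 20 7 16 ;; Load 20 20 ;; Add 21 8 16 ;; Store 21 20) ;;
     Add 21 8 14 ;; Store 21 2 ;; Add 21 8 3 ;; Store 21 14 ;; Add 21 21 2 ;; Store 21 10 ;;
     Add 8 21 2"

text \<open>The parent's flags are copied to the tail, and the flag of \<open>w\<close> is set
  afterwards. They end before the tail begins, so copying never overwrites its own source.\<close>

lemma wp_push:
  assumes "r 2 = 1" "r 3 = n" "r 14 = w" "w < n" and f: "flags m n (r 7) S" and le: "r 7 + n \<le> r 8"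
  shows "wp push_prog r m (\<lambda>t r' m'. t \<le> n * 7 + 10 \<and> (\<forall>a<r 8. m' a = m a) \<and>
     block m' n (r 8) (insert w S, w, r 10) \<and> r' 8 = r 8 + (n + 2) \<and>
     (\<forall>i. i \<notin> {8, 16, 17, 20, 21} \<longrightarrow> r' i = r i))"
proof -
  define I where "I x r' m' \<longleftrightarrow> (\<forall>a<r 8. m' a = m a) \<and> (\<forall>y<x. m' (r 8 + y) = of_bool (y \<in> S)) \<and>
      (\<forall>i. i \<notin> {16, 17, 20, 21} \<longrightarrow> r' i = r i)" for x :: nat and r' m' :: "nat \<Rightarrow> nat"
  have *: "wp (For 16 17 3 (Add 20 7 16 ;; Load 20 20 ;; Add 21 8 16 ;; Store 21 20)) r m
     (\<lambda>t r' m'. t \<le> n * (4 + 3) + 3 \<and> I n r' m')"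
  proof (rule wp_For)
    fix x and r1 m1 :: "nat \<Rightarrow> nat"
    assume x: "x < n" "I x r1 m1" "r1 16 = x" "r1 3 = n" "r1 2 = 1"
    have "m1 (r 7 + x) = m (r 7 + x)" using x le by (auto simp: I_def)
    then have "m1 (r 7 + x) = of_bool (x \<in> S)" "r1 7 = r 7" "r1 8 = r 8"
      using x f by (auto simp: I_def flags_def)
    with x show "wp (Add 20 7 16 ;; Load 20 20 ;; Add 21 8 16 ;; Store 21 20) r1 m1
        (\<lambda>t r' m'. t \<le> 4 \<and> r' 16 = x \<and> r' 3 = n \<and> r' 2 = 1 \<and>
          I (Suc x) (r'(16 := Suc x, 17 := n - Suc x)) m')"
      by (simp add: I_def less_Suc_eq)
  qed (use assms in \<open>auto simp: I_def\<close>)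
  show ?thesis
    unfolding push_prog_def wp_Seq
  proof (rule wp_mono[OF *], elim conjE)
    fix t r' m'
    assume t: "t \<le> n * (4 + 3) + 3" and I: "I n r' m'"
    then have r': "r' 2 = 1" "r' 3 = n" "r' 14 = w" "r' 8 = r 8" "r' 10 = r 10"
      "\<forall>a<r 8. m' a = m a" "\<And>y. y < n \<Longrightarrow> m' (r 8 + y) = of_bool (y \<in> S)"
      using assms by (simp_all add: I_def)
    have fr: "\<forall>i. i \<notin> {16, 17, 20, 21} \<longrightarrow> r' i = r i"
      using I by (simp add: I_def)
    show "wp (Add 21 8 14) r' m' (\<lambda>t1 r1 m1. wp (Store 21 2) r1 m1 (\<lambda>t2 r2 m2.
       wp (Add 21 8 3) r2 m2 (\<lambda>t3 r3 m3. wp (Store 21 14) r3 m3 (\<lambda>t4 r4 m4.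
       wp (Add 21 21 2) r4 m4 (\<lambda>t5 r5 m5. wp (Store 21 10) r5 m5 (\<lambda>t6 r6 m6.
       wp (Add 8 21 2) r6 m6 (\<lambda>t7 r' m'. t + (t1 + (t2 + (t3 + (t4 + (t5 + (t6 + t7)))))) \<le> n * 7 + 10 \<and>
         (\<forall>a<r 8. m' a = m a) \<and> block m' n (r 8) (insert w S, w, r 10) \<and> r' 8 = r 8 + (n + 2) \<and>
         (\<forall>i. i \<notin> {8, 16, 17, 20, 21} \<longrightarrow> r' i = r i))))))))"
      using t fr \<open>w < n\<close> by (simp add: r' flags_def)
  qed
qed

section \<open>Generating the successors of a node\<close>

definition children :: "nat \<Rightarrow> nat set set \<Rightarrow> nat set \<Rightarrow> nat \<Rightarrow> nat \<Rightarrow> node list" where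
  "children n E S v j = map (\<lambda>w. (insert w S, w, j)) (filter (\<lambda>w. w \<notin> S \<and> {v, w} \<in> E) [0..<n])"

text \<open>Matches one round of the loop in \<open>children_prog\<close>, the first argument
  doubling as the number of candidates tried so far.\<close>

lemma children_Suc:
  "children (Suc n) E S v j =
     children n E S v j @ (if n \<notin> S \<and> {v, n} \<in> E then [(insert n S, n, j)] else [])"
  by (simp add: children_def)

definition children_prog :: com where
  "children_prog = Sub 10 10 2 ;; For 14 15 3 (
     Add 20 11 14 ;; Load 20 20 ;; Add 21 7 14 ;; Load 21 21 ;; If 20 (If 21 Skip push_prog) Skip)"

lemma wp_children:
  assumes "r 2 = 1" "r 3 = n" "r 11 = 5 + v * n" "v < n" and g: "graph_mem m n E"
    and f: "flags m n (r 7) S" and le: "r 7 + n \<le> r 8" and start: "5 + n * n \<le> r 7"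
  shows "wp children_prog r m (\<lambda>t r' m'. t \<le> n * (n * 7 + 20) + 5 \<and> (\<forall>a<r 8. m' a = m a) \<and>
     queue m' n (r 8) (children n E S v (r 10 - 1)) (r' 8) \<and>
     (\<forall>i. i \<notin> {8, 10, 14, 15, 16, 17, 20, 21} \<longrightarrow> r' i = r i))"
proof -
  \<comment> \<open>The row of \<open>v\<close> lies inside the matrix and hence before the queue,
    so pushes of earlier rounds have not altered it.\<close>
  have addr: "5 + v * n + x < r 7" if "x < n" for x
  proof -
    have "Suc v * n \<le> n * n" using \<open>v < n\<close> by (intro mult_right_mono) auto
    with that start show ?thesis by simp
  qed
  define I where "I x r' m' \<longleftrightarrow> (\<forall>a<r 8. m' a = m a) \<and>
      queue m' n (r 8) (children x E S v (r 10 - 1)) (r' 8) \<and> r' 10 = r 10 - 1 \<and>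
      (\<forall>i. i \<notin> {8, 10, 14, 15, 16, 17, 20, 21} \<longrightarrow> r' i = r i)"
    for x :: nat and r' m' :: "nat \<Rightarrow> nat"
  have *: "wp (For 14 15 3 (
     Add 20 11 14 ;; Load 20 20 ;; Add 21 7 14 ;; Load 21 21 ;; If 20 (If 21 Skip push_prog) Skip))
     (r(10 := r 10 - 1)) m
     (\<lambda>t r' m'. t \<le> n * ((n * 7 + 17) + 3) + 3 \<and> I n r' m')"
  proof (rule wp_For)
    fix x and r1 m1 :: "nat \<Rightarrow> nat"
    assume x: "x < n" "I x r1 m1" "r1 14 = x" "r1 3 = n" "r1 2 = 1"
    then have r1: "r1 7 = r 7" "r1 11 = 5 + v * n" "r1 10 = r 10 - 1"
      "queue m1 n (r 8) (children x E S v (r 10 - 1)) (r1 8)" "\<forall>a<r 8. m1 a = m a"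
      and fr: "\<forall>i. i \<notin> {8, 10, 14, 15, 16, 17, 20, 21} \<longrightarrow> r1 i = r i"
      using assms by (simp_all add: I_def)
    have r8: "r 8 \<le> r1 8" using r1(4) by (rule queue_le)
    have m1: "m1 (r 7 + x) = of_bool (x \<in> S)" "m1 (5 + v * n + x) = of_bool ({v, x} \<in> E)"
      using f g r1(5) le addr[of x] \<open>x < n\<close> \<open>v < n\<close> by (simp_all add: flags_def graph_mem_def)
    have f1: "flags m1 n (r 7) S"
      using f r1(5) le by (simp add: flags_def)
    let ?r = "r1(20 := m1 (5 + v * n + x), 21 := m1 (r 7 + x))"
    have push: "wp push_prog ?r m1 (\<lambda>t r' m'. t \<le> n * 7 + 10 \<and> (\<forall>a<?r 8. m' a = m1 a) \<and>
       block m' n (?r 8) (insert x S, x, ?r 10) \<and> r' 8 = ?r 8 + (n + 2) \<and>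
       (\<forall>i. i \<notin> {8, 16, 17, 20, 21} \<longrightarrow> r' i = ?r i))"
      by (rule wp_push) (use x f1 r1 r8 le in simp_all)
    let ?Q = "\<lambda>t r' m'. t \<le> n * 7 + 17 \<and> r' 14 = x \<and> r' 3 = n \<and> r' 2 = 1 \<and>
          I (Suc x) (r'(14 := Suc x, 15 := n - Suc x)) m'"
    have "wp (If 20 (If 21 Skip push_prog) Skip) ?r m1 (\<lambda>t. ?Q (4 + t))"
    proof (cases "x \<notin> S \<and> {v, x} \<in> E")
      case False
      then show ?thesis using x r1 fr by (auto simp: m1 I_def children_Suc)
    next
      case True
      have "wp push_prog ?r m1 (\<lambda>t. ?Q (4 + (t + 1 + 1)))"
      proof (rule wp_mono[OF push], elim conjE)
        fix t r' m'
        assume *: "t \<le> n * 7 + 10" "\<forall>a<?r 8. m' a = m1 a"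
          "block m' n (?r 8) (insert x S, x, ?r 10)" "r' 8 = ?r 8 + (n + 2)"
          "\<forall>i. i \<notin> {8, 16, 17, 20, 21} \<longrightarrow> r' i = ?r i"
        have "queue m' n (r 8) (children x E S v (r 10 - 1)) (r1 8)"
          using r1(4) by (rule queue_cong) (use * in simp)
        with * have "queue m' n (r 8) (children (Suc x) E S v (r 10 - 1)) (r' 8)"
          using True r1 by (auto simp: children_Suc queue_append)
        with * x show "?Q (4 + (t + 1 + 1)) r' m'"
          using r1 r8 fr unfolding I_def by simp
      qed
      with True show ?thesis by (simp add: m1)
    qed
    then show "wp (Add 20 11 14 ;; Load 20 20 ;; Add 21 7 14 ;; Load 21 21 ;;
       If 20 (If 21 Skip push_prog) Skip) r1 m1 ?Q"
      using x by (simp add: r1 fun_upd_twist del: wp_If)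
  qed (use assms in \<open>auto simp: I_def children_def\<close>)
  from this show ?thesis
    unfolding children_prog_def I_def using assms(1)
    by simp (erule wp_mono, auto simp: algebra_simps)
qed

section \<open>One round of the main loop\<close>

text \<open>Truncated subtraction replaces comparisons: \<open>v - t\<close>, \<open>t - v\<close>
  and the excess of the neighbourhood over \<open>l\<close> sum to 0 exactly if the node is
  accepted.\<close>

definition accept_prog :: com where
  "accept_prog = Sub 20 9 4 ;; Sub 21 4 9 ;; Add 20 20 21 ;; Sub 21 12 6 ;; Add 20 20 21 ;;
     If 20 Skip (Const 22 1)"

definition expand_prog :: com where
  "expand_prog = Sub 20 5 13 ;; If 20 (If 10 children_prog Skip) Skip"

definition visit_prog :: com where
  "visit_prog = row_prog ;; count_prog ;; accept_prog ;; expand_prog"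

definition body_prog :: com where
  "body_prog = Add 20 7 3 ;; Load 9 20 ;; Add 20 20 2 ;; Load 10 20 ;; Const 12 0 ;; Const 13 0 ;;
     visit_prog ;;
     Add 7 7 3 ;; Add 7 7 2 ;; Add 7 7 2 ;; Sub 23 8 7"

fun succs :: "nat \<Rightarrow> nat set set \<Rightarrow> nat \<Rightarrow> node \<Rightarrow> node list" where
  "succs n E D (S, v, j) =
     (if card {w. w < n \<and> {v, w} \<in> E} < D \<and> j \<noteq> 0 then children n E S v (j - 1) else [])"

text \<open>The length bound is not tested, as \<open>valid\<close> keeps \<open>card S\<close> at
  most \<open>k\<close>. The neighbourhood has the form computed by \<open>count_prog\<close>;
  \<open>open_nbhd_lessThan\<close> identifies it.\<close>

fun accepts :: "nat \<Rightarrow> nat set set \<Rightarrow> nat \<Rightarrow> nat \<Rightarrow> node \<Rightarrow> bool" where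
  "accepts n E t l (S, v, j) \<longleftrightarrow>
     v = t \<and> card {w. w < n \<and> w \<notin> S \<and> (\<exists>u<n. u \<in> S \<and> {u, w} \<in> E)} \<le> l"

text \<open>The time adds up \<open>4 * n\<close> for the row address,
  \<open>10 * n^2 + 20 * n\<close> for counting, \<open>7 * n^2 + 20 * n\<close> for the children,
  and constants.\<close>

lemma wp_body:
  assumes regs: "r 2 = 1" "r 3 = n" "r 4 = t" "r 5 = D" "r 6 = l"
    and g: "graph_mem m n E" and b: "block m n (r 7) (S, v, j)" and "v < n"
    and le: "r 7 + (n + 2) \<le> r 8" and start: "5 + n * n \<le> r 7"
  shows "wp body_prog r m (\<lambda>T r' m'. T \<le> 17 * (n * n) + 44 * n + 40 \<and> (\<forall>a<r 8. m' a = m a) \<and>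
     queue m' n (r 8) (succs n E D (S, v, j)) (r' 8) \<and> r' 7 = r 7 + (n + 2) \<and>
     r' 22 = (if accepts n E t l (S, v, j) then 1 else r 22) \<and> r' 23 = r' 8 - r' 7 \<and>
     (\<forall>i. i \<in> {2, 3, 4, 5, 6} \<longrightarrow> r' i = r i))"
proof -
  let ?deg = "card {w. w < n \<and> {v, w} \<in> E}"
  let ?nb = "card {w. w < n \<and> w \<notin> S \<and> (\<exists>u<n. u \<in> S \<and> {u, w} \<in> E)}"
  let ?E = "\<lambda>T r' m'. T \<le> n * (n * 7 + 20) + 8 \<and> (\<forall>a<r 8. m' a = m a) \<and>
     queue m' n (r 8) (succs n E D (S, v, j)) (r' 8) \<and>
     r' 22 = (if accepts n E t l (S, v, j) then 1 else r 22) \<and>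
     (\<forall>i. i \<in> {2, 3, 4, 5, 6, 7} \<longrightarrow> r' i = r i)"
  have vj: "m (r 7 + n) = v" "m (Suc (r 7 + n)) = j" and f: "flags m n (r 7) S"
    using b by simp_all
  have expand: "wp expand_prog r1 m ?E"
    if r1: "r1 11 = 5 + v * n" "r1 13 = ?deg" "r1 10 = j"
      "r1 22 = (if accepts n E t l (S, v, j) then 1 else r 22)"
      "\<forall>i. i \<in> {2, 3, 4, 5, 6, 7, 8} \<longrightarrow> r1 i = r i" for r1
  proof -
    let ?r = "r1(20 := D - ?deg)"
    have "wp children_prog ?r m (\<lambda>t r' m'. t \<le> n * (n * 7 + 20) + 5 \<and> (\<forall>a<?r 8. m' a = m a) \<and>
       queue m' n (?r 8) (children n E S v (?r 10 - 1)) (r' 8) \<and>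
       (\<forall>i. i \<notin> {8, 10, 14, 15, 16, 17, 20, 21} \<longrightarrow> r' i = ?r i))"
      by (rule wp_children) (use r1 regs f g le start \<open>v < n\<close> in auto)
    then have "wp children_prog ?r m (\<lambda>t. ?E (1 + (t + 1 + 1)))" if "?deg < D" "j \<noteq> 0"
      by (rule wp_mono) (use that r1 in \<open>auto simp del: accepts.simps\<close>)
    then show ?thesis
      using r1 regs by (auto simp: expand_prog_def simp del: accepts.simps)
  qed
  have accept: "wp accept_prog r1 m (\<lambda>T r' m'. T \<le> 7 \<and> m' = m \<and>
      r' 22 = (if accepts n E t l (S, v, j) then 1 else r1 22) \<and>
      (\<forall>i. i \<notin> {20, 21, 22} \<longrightarrow> r' i = r1 i))"
    if "r1 9 = v" "r1 12 = ?nb" "r1 4 = t" "r1 6 = l" for r1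
    using that by (auto simp: accept_prog_def)
  let ?r = "r(9 := v, 10 := j, 12 := 0, 13 := 0, 20 := Suc (r 7 + n))"
  have row: "wp row_prog ?r m (\<lambda>t r' m'. t \<le> v * 4 + 4 \<and> m' = m \<and> r' 11 = 5 + v * n \<and>
     (\<forall>i. i \<notin> {11, 14, 15} \<longrightarrow> r' i = ?r i))"
    by (rule wp_row) (use regs in simp_all)
  let ?E' = "\<lambda>T r' m'. T \<le> 17 * (n * n) + 44 * n + 30 \<and> (\<forall>a<r 8. m' a = m a) \<and>
     queue m' n (r 8) (succs n E D (S, v, j)) (r' 8) \<and>
     r' 22 = (if accepts n E t l (S, v, j) then 1 else r 22) \<and>
     (\<forall>i. i \<in> {2, 3, 4, 5, 6, 7} \<longrightarrow> r' i = r i)"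
  have core: "wp visit_prog ?r m ?E'"
    unfolding visit_prog_def wp_Seq
  proof (rule wp_mono[OF row], elim conjE)
    fix T1 r1 m1
    assume 1: "T1 \<le> v * 4 + 4" "m1 = m" "r1 11 = 5 + v * n"
      "\<forall>i. i \<notin> {11, 14, 15} \<longrightarrow> r1 i = ?r i"
    have count: "wp count_prog r1 m (\<lambda>t r' m'. t \<le> n * (n * 10 + 20) + 3 \<and> m' = m \<and>
       r' 12 = ?nb \<and> r' 13 = ?deg \<and>
       (\<forall>i. i \<notin> {12, 13, 14, 15, 16, 17, 18, 19, 20, 21} \<longrightarrow> r' i = r1 i))"
      by (rule wp_count) (use 1 regs f g \<open>v < n\<close> in simp_all)
    show "wp count_prog r1 m1 (\<lambda>t1 r1 m1. wp accept_prog r1 m1 (\<lambda>t2 r1 m1.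
       wp expand_prog r1 m1 (\<lambda>t3. ?E' (T1 + (t1 + (t2 + t3))))))"
      unfolding \<open>m1 = m\<close>
    proof (rule wp_mono[OF count], elim conjE)
      fix T2 r2 m2
      assume 2: "T2 \<le> n * (n * 10 + 20) + 3" "m2 = m" "r2 12 = ?nb" "r2 13 = ?deg"
        "\<forall>i. i \<notin> {12, 13, 14, 15, 16, 17, 18, 19, 20, 21} \<longrightarrow> r2 i = r1 i"
      have r2: "r2 9 = v" "r2 10 = j" "r2 11 = 5 + v * n" "r2 22 = r 22"
        "\<forall>i. i \<in> {2, 3, 4, 5, 6, 7, 8} \<longrightarrow> r2 i = r i"
        using 1 2 by auto
      show "wp accept_prog r2 m2 (\<lambda>t2 r1 m1.
         wp expand_prog r1 m1 (\<lambda>t3. ?E' (T1 + (T2 + (t2 + t3)))))"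
        unfolding \<open>m2 = m\<close>
      proof (rule wp_mono[OF accept], goal_cases)
        case (5 T3 r3 m3)
        then have m3: "m3 = m" "T3 \<le> 7" by auto
        have "wp expand_prog r3 m ?E"
          by (rule expand) (use 5 r2 2 in \<open>auto simp del: accepts.simps\<close>)
        then show ?case unfolding m3(1)
        proof (rule wp_mono, elim conjE, intro conjI)
          fix T4 assume 4: "T4 \<le> n * (n * 7 + 20) + 8"
          have "v * 4 \<le> 4 * n" using \<open>v < n\<close> by simp
          with 1 2 m3 4 show "T1 + (T2 + (T3 + T4)) \<le> 17 * (n * n) + 44 * n + 30"
            by (simp add: algebra_simps)
        qed
      qed (use 2 r2 regs in simp_all)
    qed
  qed
  have "wp visit_prog (r(20 := Suc (r 7 + n), 9 := v, 10 := j, 12 := 0, 13 := 0)) m ?E'"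
    using core by (simp add: fun_upd_twist)
  then show ?thesis
    unfolding body_prog_def using regs vj
    by (simp add: fun_upd_twist del: accepts.simps succs.simps split del: if_split)
      (erule wp_mono, auto simp del: accepts.simps succs.simps)
qed

section \<open>Correctness and size of the search tree\<close>

text \<open>Of a partial path only the set \<open>S\<close> and the endpoint are kept, because
  disjointness and the final neighbourhood depend on nothing else. The completing path repeats
  \<open>v\<close>, hence \<open>{v}\<close> and \<open>Suc j\<close>.\<close>

definition completable :: "nat \<Rightarrow> nat set set \<Rightarrow> nat \<Rightarrow> nat \<Rightarrow> node \<Rightarrow> bool" where
  "completable n E t l = (\<lambda>(S, v, j). \<exists>p. simple_path {..<n} E v t p \<and> set p \<inter> S = {v} \<and>
     length p \<le> Suc j \<and> card (open_nbhd {..<n} E (S \<union> set p)) \<le> l)"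

definition valid :: "nat \<Rightarrow> nat \<Rightarrow> node \<Rightarrow> bool" where
  "valid n k = (\<lambda>(S, v, j). S \<subseteq> {..<n} \<and> v \<in> S \<and> card S + j \<le> k)"

lemma open_nbhd_lessThan:
  assumes "S \<subseteq> {..<n}"
  shows "open_nbhd {..<n} E S = {w. w < n \<and> w \<notin> S \<and> (\<exists>u<n. u \<in> S \<and> {u, w} \<in> E)}"
  using assms by (auto simp: open_nbhd_def insert_commute)

text \<open>A completing path is either \<open>[v]\<close>, and the node accepts, or its second
  vertex gives a child completed by the rest; conversely, a child's path is prefixed with
  \<open>v\<close>. Pruning loses nothing: all neighbours of \<open>v\<close> lie in the completed
  vertex set without \<open>v\<close> or in its neighbourhood, so there are at most
  \<open>(k - 1) + l\<close> of them.\<close>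

lemma completable_iff:
  assumes E: "simple_graph {..<n} E" and valid: "valid n k (S, v, j)"
  shows "completable n E t l (S, v, j) \<longleftrightarrow>
    accepts n E t l (S, v, j) \<or> (\<exists>x\<in>set (succs n E (k + l) (S, v, j)). completable n E t l x)"
proof
  have S: "S \<subseteq> {..<n}" "v \<in> S" "card S + j \<le> k" and "v < n"
    using valid by (auto simp: valid_def)
  have noloop: "{v, v} \<notin> E"
    using E by (auto simp: simple_graph_def)
  {
    assume "completable n E t l (S, v, j)"
    then obtain p where p: "simple_path {..<n} E v t p" "set p \<inter> S = {v}"
      "length p \<le> Suc j" "card (open_nbhd {..<n} E (S \<union> set p)) \<le> l"
      by (auto simp: completable_def)
    obtain q where q: "p = v # q" using p(1) by (cases p) (auto simp: simple_path_def)
    show "accepts n E t l (S, v, j) \<or> (\<exists>x\<in>set (succs n E (k + l) (S, v, j)). completable n E t l x)"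
    proof (cases q)
      case Nil
      with p(1) q have "v = t" by (simp add: simple_path_def)
      moreover have "S \<union> set p = S" using q Nil S by auto
      ultimately show ?thesis using p(4) S(1) by (simp add: open_nbhd_lessThan)
    next
      case (Cons u q')
      have u: "u < n" "u \<notin> S" "{v, u} \<in> E" "v \<notin> set q" "j \<noteq> 0"
        using p q Cons by (auto simp: simple_path_def)
      have "simple_path {..<n} E u t q" "set q \<inter> insert u S = {u}" "length q \<le> Suc (j - 1)"
        "insert u S \<union> set q = S \<union> set p"
        using p q Cons S by (auto simp: simple_path_def)
      with p(4) have completable: "completable n E t l (insert u S, u, j - 1)"
        unfolding completable_def by auto
      have fin: "finite (S \<union> set p)" using S(1) finite_subset by auto
      \<comment> \<open>\<open>v\<close> is already counted in \<open>S\<close>, so the path adds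
        only the vertices of \<open>q\<close>, at most \<open>j\<close>.\<close>
      have cS: "card (S \<union> set p) \<le> k"
      proof -
        have "S \<union> set p = S \<union> set q" using q S by auto
        then have "card (S \<union> set p) \<le> card S + card (set q)" by (simp add: card_Un_le)
        also have "card (set q) \<le> j" using p(3) q card_length[of q] by simp
        finally show ?thesis using S by linarith
      qed
      have "{w. w < n \<and> {v, w} \<in> E} \<subseteq> (S \<union> set p - {v}) \<union> open_nbhd {..<n} E (S \<union> set p)"
        using S noloop by (auto simp: open_nbhd_def insert_commute)
      then have "card {w. w < n \<and> {v, w} \<in> E} \<le>
          card ((S \<union> set p - {v}) \<union> open_nbhd {..<n} E (S \<union> set p))"
        by (rule card_mono[rotated]) (use fin in \<open>auto simp: open_nbhd_def\<close>)
      also have "\<dots> \<le> card (S \<union> set p - {v}) + l"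
        using p(4) card_Un_le[of "S \<union> set p - {v}" "open_nbhd {..<n} E (S \<union> set p)"] by linarith
      also have "\<dots> < card (S \<union> set p) + l"
        using fin S by (intro add_strict_right_mono card_Diff1_less) auto
      finally have "card {w. w < n \<and> {v, w} \<in> E} < k + l" using cS by linarith
      with u completable show ?thesis
        by (auto simp: children_def)
    qed
  next
    assume "accepts n E t l (S, v, j) \<or> (\<exists>x\<in>set (succs n E (k + l) (S, v, j)). completable n E t l x)"
    then show "completable n E t l (S, v, j)"
    proof
      assume "accepts n E t l (S, v, j)"
      with S \<open>v < n\<close> show ?thesis
        by (auto simp: completable_def simple_path_def open_nbhd_lessThan insert_absorb
            intro!: exI[of _ "[v]"])
    next
      assume "\<exists>x\<in>set (succs n E (k + l) (S, v, j)). completable n E t l x"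
      then obtain u where u: "u < n" "u \<notin> S" "{v, u} \<in> E" "j \<noteq> 0"
        and "completable n E t l (insert u S, u, j - 1)"
        by (auto simp: children_def split: if_splits)
      then obtain q where q: "simple_path {..<n} E u t q" "set q \<inter> insert u S = {u}"
        "length q \<le> Suc (j - 1)" "card (open_nbhd {..<n} E (insert u S \<union> set q)) \<le> l"
        by (auto simp: completable_def)
      have vq: "v \<notin> set q" using q(2) u S by auto
      have "simple_path {..<n} E v t (v # q)"
        using q(1) vq u \<open>v < n\<close> by (cases q) (auto simp: simple_path_def)
      moreover have "u \<in> set q" using q(2) by auto
      then have "set (v # q) \<inter> S = {v}" "S \<union> set (v # q) = insert u S \<union> set q"
        using q(2) S u by auto
      moreover have "length (v # q) \<le> Suc j" using q(3) u by simp
      ultimately show ?thesis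
        using q(4) unfolding completable_def by (metis (mono_tags, lifting) case_prod_conv)
    qed
  }
qed

lemma valid_succs:
  assumes "valid n k (S, v, j)" "x \<in> set (succs n E D (S, v, j))"
  shows "valid n k x"
proof -
  have "finite S" using assms finite_subset by (auto simp: valid_def)
  with assms show ?thesis by (auto simp: valid_def children_def split: if_splits)
qed

text \<open>Size of the complete \<open>d\<close>-ary tree of depth \<open>j\<close>, the potential of a queued node.\<close>

fun weight :: "nat \<Rightarrow> nat \<Rightarrow> nat" where
  "weight d 0 = 1"
| "weight d (Suc j) = 1 + d * weight d j"

lemma weight_le: "weight d j \<le> Suc d ^ j"
proof (induction j)
  case (Suc j)
  have "1 + d * weight d j \<le> Suc d ^ j + d * Suc d ^ j"
    using Suc by (intro add_mono mult_left_mono) simp_all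
  then show ?case by simp
qed simp

definition total_weight :: "nat \<Rightarrow> node list \<Rightarrow> nat" where
  "total_weight d xs = (\<Sum>(S, v, j)\<leftarrow>xs. weight d j)"

text \<open>Nodes with more than \<open>d\<close> neighbours have no successors; the others have at
  most \<open>d\<close>, each of weight \<open>weight d (j - 1)\<close>, and none if
  \<open>j = 0\<close>. The summand 1 in \<open>weight\<close> pays for the node removed.\<close>

lemma total_weight_succs:
  "total_weight d (succs n E (Suc d) (S, v, j)) < weight d j"
proof (cases "card {w. w < n \<and> {v, w} \<in> E} < Suc d \<and> j \<noteq> 0")
  case True
  then obtain i where j: "j = Suc i" by (cases j) auto
  have "total_weight d (children n E S v i) =
      length (filter (\<lambda>w. w \<notin> S \<and> {v, w} \<in> E) [0..<n]) * weight d i"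
    by (simp add: total_weight_def children_def o_def sum_list_triv)
  also have "length (filter (\<lambda>w. w \<notin> S \<and> {v, w} \<in> E) [0..<n]) =
      card {w. w < n \<and> w \<notin> S \<and> {v, w} \<in> E}"
    by (subst distinct_length_filter) (auto intro!: arg_cong[where f = card])
  also have "\<dots> \<le> card {w. w < n \<and> {v, w} \<in> E}"
    by (rule card_mono) auto
  also have "\<dots> \<le> d" using True by simp
  finally show ?thesis using True j by (simp add: le_imp_less_Suc)
qed (cases j; auto simp: total_weight_def)

section \<open>The decision procedure\<close>

text \<open>The queue starts at the input length, found in register 0. The cells there are initially
  0, so the root needs only the flag of the source, the endpoint and \<open>k - 1\<close>.
  \<open>Add\<close> with register 20 set to 0 serves as a copy.\<close>

definition main_prog :: com where
  "main_prog = Const 2 1 ;; Const 20 0 ;; Load 3 20 ;; Load 21 2 ;; Add 20 2 2 ;; Load 4 20 ;;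
     Add 20 20 2 ;; Load 5 20 ;; Add 20 20 2 ;; Load 6 20 ;; Sub 24 5 2 ;; Add 5 5 6 ;;
     Const 20 0 ;; Add 7 0 20 ;; Add 20 7 21 ;; Store 20 2 ;; Add 20 7 3 ;; Store 20 21 ;;
     Add 20 20 2 ;; Store 20 24 ;; Add 8 20 2 ;; Sub 23 8 7 ;; While 23 body_prog ;;
     Const 20 0 ;; Add 0 22 20"

text \<open>\<open>Y\<close> is the fixed answer of the instance: as long as register 22 is not 1,
  it rests on the queued nodes alone. \<open>z\<close> is the potential for
  \<open>wp_While\<close>.\<close>

definition queue_inv ::
  "nat \<Rightarrow> nat set set \<Rightarrow> nat \<Rightarrow> nat \<Rightarrow> nat \<Rightarrow> bool \<Rightarrow> nat \<Rightarrow> (nat \<Rightarrow> nat) \<Rightarrow> (nat \<Rightarrow> nat) \<Rightarrow> bool" where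
  "queue_inv n E t k l Y z r m \<longleftrightarrow> (\<exists>xs.
     r 2 = 1 \<and> r 3 = n \<and> r 4 = t \<and> r 5 = k + l \<and> r 6 = l \<and> graph_mem m n E \<and>
     5 + n * n \<le> r 7 \<and> queue m n (r 7) xs (r 8) \<and> r 23 = r 8 - r 7 \<and>
     (\<forall>x\<in>set xs. valid n k x) \<and> r 22 \<le> 1 \<and>
     (Y \<longleftrightarrow> r 22 = 1 \<or> (\<exists>x\<in>set xs. completable n E t l x)) \<and>
     z = total_weight (k + l - 1) xs)"

text \<open>Replacing the head by its successors preserves \<open>Y\<close> by
  \<open>completable_iff\<close> and lowers the total weight by \<open>total_weight_succs\<close>.
  Nothing below the old tail is written, so the graph and the rest of the queue survive.\<close>

lemma wp_body_queue_inv: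
  assumes E: "simple_graph {..<n} E" and "k \<ge> 1"
    and I: "queue_inv n E t k l Y z r m" and nz: "r 23 \<noteq> 0"
  shows "wp body_prog r m (\<lambda>T r' m'. T \<le> 17 * (n * n) + 44 * n + 40 \<and>
    (\<exists>z'<z. queue_inv n E t k l Y z' r' m'))"
proof -
  obtain xs where xs:
     "r 2 = 1" "r 3 = n" "r 4 = t" "r 5 = k + l" "r 6 = l" "graph_mem m n E"
     "5 + n * n \<le> r 7" "queue m n (r 7) xs (r 8)" "r 23 = r 8 - r 7"
     "\<forall>x\<in>set xs. valid n k x" "r 22 \<le> 1"
     "Y \<longleftrightarrow> r 22 = 1 \<or> (\<exists>x\<in>set xs. completable n E t l x)" "z = total_weight (k + l - 1) xs"
    using I unfolding queue_inv_def by blast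
  with nz obtain S v j ys where x: "xs = (S, v, j) # ys"
    by (cases xs) auto
  let ?x = "(S, v, j)"
  have valid: "valid n k ?x" and "block m n (r 7) ?x" and "queue m n (r 7 + (n + 2)) ys (r 8)"
    using xs x by simp_all
  then have le: "r 7 + (n + 2) \<le> r 8" by (blast dest: queue_le)
  have "v < n" using valid by (auto simp: valid_def)
  show ?thesis
  proof (rule wp_mono[OF wp_body[OF xs(1-6) \<open>block m n (r 7) ?x\<close> \<open>v < n\<close> le xs(7)]],
      elim conjE, intro conjI)
    fix T r' m'
    assume r': "\<forall>a<r 8. m' a = m a" "queue m' n (r 8) (succs n E (k + l) ?x) (r' 8)"
      "r' 7 = r 7 + (n + 2)" "r' 22 = (if accepts n E t l ?x then 1 else r 22)"
      "r' 23 = r' 8 - r' 7" "\<forall>i. i \<in> {2, 3, 4, 5, 6} \<longrightarrow> r' i = r i"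
    let ?ys = "ys @ succs n E (k + l) ?x"
    have "queue m' n (r' 7) ys (r 8)"
      using \<open>queue m n (r 7 + (n + 2)) ys (r 8)\<close> unfolding r'(3)
      by (rule queue_cong) (use r' in simp)
    with r' have q: "queue m' n (r' 7) ?ys (r' 8)"
      unfolding queue_append by blast
    have g: "graph_mem m' n E"
      unfolding graph_mem_def
    proof (intro allI impI)
      fix u w assume uw: "u < n" "w < n"
      have "Suc u * n \<le> n * n" using uw by (intro mult_right_mono) auto
      then have "5 + u * n + w < r 8" using uw xs(7) le by simp
      with r' uw xs(6) show "m' (5 + u * n + w) = of_bool ({u, w} \<in> E)"
        by (simp add: graph_mem_def)
    qed
    \<comment> \<open>\<open>total_weight_succs\<close> has the degree threshold
      \<open>Suc d\<close>; \<open>k \<ge> 1\<close> brings \<open>k + l\<close> into that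
      form.\<close>
    have Suc: "k + l = Suc (k + l - 1)" using \<open>k \<ge> 1\<close> by simp
    have w: "total_weight (k + l - 1) ?ys < z"
      using total_weight_succs[of "k + l - 1" n E S v j] unfolding xs(13) x Suc[symmetric]
      by (simp add: total_weight_def del: succs.simps)
    have v: "\<forall>x\<in>set ?ys. valid n k x"
      using xs(10) x valid_succs[OF valid] by auto
    have Y: "Y \<longleftrightarrow> r' 22 = 1 \<or> (\<exists>x\<in>set ?ys. completable n E t l x)"
      using xs(12) x r'(4) completable_iff[OF E valid, of t l] by (auto simp del: succs.simps accepts.simps)
    show "\<exists>z'<z. queue_inv n E t k l Y z' r' m'"
      unfolding queue_inv_def using q g w v Y r' xs
      by (intro exI[of _ "total_weight (k + l - 1) ?ys"] conjI exI[of _ ?ys])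
        (simp_all del: succs.simps accepts.simps)
  qed
qed

section \<open>The encoding and the root of the search tree\<close>

lemma ssp_encode_nth:
  assumes "u < order x" "v < order x"
  shows "ssp_encode x ! (5 + u * order x + v) = of_bool ({u, v} \<in> edges x)"
    and "5 + u * order x + v < length (ssp_encode x)"
proof -
  let ?n = "order x"
  let ?row = "\<lambda>u. map (\<lambda>v. if {u, v} \<in> edges x then 1 else 0 :: nat) [0..<?n]"
  have len: "length (concat (map ?row xs)) = length xs * ?n" for xs
    by (induction xs) auto
  \<comment> \<open>Stated for any list of rows, since the induction peels off the first
    row.\<close>
  have nth: "concat (map ?row xs) ! (i * ?n + v) = of_bool ({xs ! i, v} \<in> edges x)"
    if "i < length xs" for xs i
    using that
  proof (induction xs arbitrary: i)
    case (Cons a xs)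
    then show ?case using assms(2) by (cases i) (simp_all add: nth_append)
  qed simp
  show "ssp_encode x ! (5 + u * ?n + v) = of_bool ({u, v} \<in> edges x)"
    using nth[of u "[0..<?n]"] assms(1) by (simp add: ssp_encode_def)
  have "Suc u * ?n \<le> ?n * ?n" using assms by (intro mult_right_mono) auto
  then show "5 + u * ?n + v < length (ssp_encode x)"
    using assms(2) by (simp add: ssp_encode_def len)
qed

lemma length_ssp_encode: "length (ssp_encode x) = 5 + order x * order x"
  by (simp add: ssp_encode_def length_concat o_def sum_list_triv)

text \<open>The root already contains the source, so \<open>k - 1\<close> further vertices remain;
  on a simple path the list length is the number of vertices.\<close>

lemma ssp_yes_iff_completable:
  assumes "source x < order x" "len_bound x \<ge> 1"
  shows "ssp_yes x \<longleftrightarrow> completable (order x) (edges x) (target x) (nbhd_bound x)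
     ({source x}, source x, len_bound x - 1)"
proof -
  have "card (set p) = length p" "set p \<inter> {source x} = {source x}" "{source x} \<union> set p = set p"
    if "simple_path {..<order x} (edges x) (source x) (target x) p" for p
    using that hd_in_set[of p] by (auto simp: simple_path_def distinct_card)
  then show ?thesis
    using assms unfolding ssp_yes_def has_short_secluded_path_def completable_def prod.case
    by (metis One_nat_def Suc_diff_1 Suc_le_eq)
qed

lemma main_prog_correct:
  assumes x: "x \<in> ssp_instances"
  shows "decides_within main_prog (ssp_encode x) (ssp_yes x)
     (150 * (len_bound x + nbhd_bound x) ^ len_bound x * order x ^ 2)"
proof -
  let ?n = "order x" and ?E = "edges x" and ?s = "source x" and ?t = "target x"
    and ?k = "len_bound x" and ?l = "nbhd_bound x"
  have inst: "simple_graph {..<?n} ?E" "?s < ?n" "?k \<ge> 2"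
    using x by (auto simp: ssp_instances_def)
  let ?L = "5 + ?n * ?n"
  define r where "r = fst (input_state (ssp_encode x))"
  define m where "m = snd (input_state (ssp_encode x))"
  have r: "r 0 = ?L" "r 22 = 0"
    by (simp_all add: r_def input_state_def length_ssp_encode)
  have len: "0 < length (ssp_encode x)" "1 < length (ssp_encode x)" "2 < length (ssp_encode x)"
    "3 < length (ssp_encode x)" "4 < length (ssp_encode x)"
    by (simp_all add: length_ssp_encode)
  have m: "m 0 = ?n" "m (Suc 0) = ?s" "m 2 = ?t" "m 3 = ?k" "m 4 = ?l"
    using len by (simp_all add: m_def input_state_def) (simp_all add: ssp_encode_def)
  have m_Suc: "m (Suc (Suc 0)) = ?t" "m (Suc (Suc (Suc 0))) = ?k" "m (Suc (Suc (Suc (Suc 0)))) = ?l"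
    using m by (simp_all add: eval_nat_numeral)
  have m0: "m a = 0" if "a \<ge> ?L" for a
    using that by (simp add: m_def input_state_def length_ssp_encode)
  have g: "graph_mem m ?n ?E"
    using ssp_encode_nth by (simp add: graph_mem_def m_def input_state_def)
  define x0 where "x0 = ({?s}, ?s, ?k - 1)"
  define z where "z = total_weight (?k + ?l - 1) [x0]"
  let ?T = "17 * (?n * ?n) + 44 * ?n + 40"
  let ?I = "queue_inv ?n ?E ?t ?k ?l (ssp_yes x)"
  \<comment> \<open>The state on entering the loop: the queue holds just the root, a block of
    \<open>n + 2\<close> cells.\<close>
  define r1 where "r1 = r(2 := 1, 3 := ?n, 21 := ?s, 4 := ?t, 5 := ?k + ?l, 6 := ?l, 24 := ?k - 1,
     7 := ?L, 20 := Suc (?L + ?n), 8 := Suc (Suc (?L + ?n)), 23 := Suc (Suc ?n))"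
  define m1 where "m1 = m(?L + ?s := 1, ?L + ?n := ?s, Suc (?L + ?n) := ?k - 1)"
  have g1: "graph_mem m1 ?n ?E"
    unfolding graph_mem_def
  proof (intro allI impI)
    fix u w assume uw: "u < ?n" "w < ?n"
    have "5 + u * ?n + w < ?L"
      using ssp_encode_nth(2)[OF uw] by (simp add: length_ssp_encode)
    then show "m1 (5 + u * ?n + w) = of_bool ({u, w} \<in> ?E)"
      using g uw by (simp add: m1_def graph_mem_def)
  qed
  have "block m1 ?n ?L x0"
    using inst m0 by (auto simp: x0_def flags_def m1_def)
  then have I: "?I z r1 m1"
    unfolding queue_inv_def using g1 r inst ssp_yes_iff_completable[of x]
    by (intro exI[of _ "[x0]"]) (auto simp: r1_def z_def valid_def x0_def)
  have while: "wp (While 23 body_prog) r1 m1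
     (\<lambda>t r' m'. t \<le> z * (?T + 1) + 1 \<and> r' 23 = 0 \<and> (\<exists>z'. ?I z' r' m'))"
    by (rule wp_While[where I = ?I]) (use wp_body_queue_inv inst I in auto)
  \<comment> \<open>The 24 are the instructions outside the loop: 22 before it and 2 after
    it.\<close>
  have "wp (While 23 body_prog) r1 m1
     (\<lambda>t r' m'. t + 24 \<le> z * (?T + 1) + 25 \<and> r' 22 = of_bool (ssp_yes x))"
    using while
  proof (rule wp_mono, elim conjE exE, intro conjI)
    fix t r' m' z'
    assume "r' 23 = 0" "?I z' r' m'"
    then obtain xs where xs: "queue m' ?n (r' 7) xs (r' 8)" "r' 8 \<le> r' 7" "r' 22 \<le> 1"
       "ssp_yes x \<longleftrightarrow> r' 22 = 1 \<or> (\<exists>y\<in>set xs. completable ?n ?E ?t ?l y)"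
      unfolding queue_inv_def by auto
    \<comment> \<open>Guard 0 means that the tail does not exceed the head; the queue is then empty
      and register 22 alone carries the answer.\<close>
    have "xs = []"
      using xs(1,2) by (cases xs) (auto dest: queue_le)
    with xs show "r' 22 = of_bool (ssp_yes x)" by (cases "r' 22") auto
  qed simp
  then have "wp main_prog r m (\<lambda>t r' m'. t \<le> z * (?T + 1) + 25 \<and> r' 0 = of_bool (ssp_yes x))"
    unfolding main_prog_def using r m m_Suc
    by (simp add: r1_def m1_def fun_upd_twist split del: split_of_bool)
  then obtain t r' m' where run: "exec main_prog (r, m) t (r', m')"
    "t \<le> z * (?T + 1) + 25" "r' 0 = of_bool (ssp_yes x)"
    unfolding wp_def by blast
  let ?K = "(?k + ?l) ^ ?k"
  \<comment> \<open>\<open>z\<close> is the weight of the root; for \<open>d = k + l - 1\<close> the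
    base \<open>Suc d\<close> in \<open>weight_le\<close> is \<open>k + l\<close>.\<close>
  have "z \<le> (?k + ?l) ^ (?k - 1)"
    using weight_le[of "?k + ?l - 1" "?k - 1"] inst by (simp add: z_def total_weight_def x0_def)
  also have "\<dots> \<le> ?K" using inst by (intro power_increasing) auto
  finally have z: "z \<le> ?K" .
  have n: "?n \<le> ?n * ?n" "1 \<le> ?n * ?n" using inst by (cases ?n; simp)+
  have K: "1 \<le> ?K" using inst by simp
  \<comment> \<open>\<open>102 = 17 + 44 + 41\<close>. The remaining 25 steps are absorbed into 150
    because the product is at least 1.\<close>
  have "?T + 1 \<le> 102 * (?n * ?n)" using n by linarith
  with z have "z * (?T + 1) \<le> ?K * (102 * (?n * ?n))"
    by (rule mult_mono) auto
  also have "\<dots> = 102 * (?K * (?n * ?n))" by (rule mult.left_commute)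
  finally have "t \<le> 102 * (?K * (?n * ?n)) + 25" using run(2) by linarith
  moreover have "1 \<le> ?K * (?n * ?n)"
    using mult_mono[OF K n(2)] by simp
  moreover have "150 * ?K * ?n ^ 2 = 150 * (?K * (?n * ?n))"
    by (simp only: power2_eq_square mult.assoc)
  ultimately have "t \<le> 150 * ?K * ?n ^ 2" by linarith
  with run(1,3) show ?thesis
    unfolding decides_within_def outputs_within_def r_def m_def
    by (intro exI[of _ t] conjI exI[of _ "(r', m')"]) simp_all
qed

text \<open>
  \<open>2 ^ (x * x)\<close> dominates \<open>x ^ x\<close> and needs only repeated doubling, as multiplication is not primitive.
\<close>

definition bound_prog :: com where
  "bound_prog = Const 2 1 ;; Const 20 0 ;; Load 3 20 ;; Const 10 150 ;;
     For 4 5 3 (For 6 7 3 (Add 10 10 10)) ;; Add 0 10 20"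

lemma computable_bound: "computable (\<lambda>x. 150 * 2 ^ (x * x))"
  unfolding computable_def
proof (intro exI allI)
  fix x :: nat
  define r where "r = fst (input_state [x])"
  define m where "m = snd (input_state [x])"
  have m: "m 0 = x" by (simp add: m_def input_state_def)
  \<comment> \<open>\<open>e\<close> is the number of doublings done; round \<open>y\<close> of the
    outer loop starts at \<open>y * x\<close>.\<close>
  define J where "J e r' m' \<longleftrightarrow> r' 10 = 150 * 2 ^ e \<and> r' 2 = 1 \<and> r' 3 = x \<and> r' 20 = 0"
    for e :: nat and r' m' :: "nat \<Rightarrow> nat"
  have inner: "wp (For 6 7 3 (Add 10 10 10)) r1 m1
      (\<lambda>t r' m'. t \<le> x * (1 + 3) + 3 \<and> J (y * x + x) r' m' \<and> r' 4 = y)"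
    if "J (y * x) r1 m1" "r1 4 = y" for r1 m1 y
    by (rule wp_For[where I = "\<lambda>z r' m'. J (y * x + z) r' m' \<and> r' 4 = y"])
      (use that in \<open>auto simp: J_def\<close>)
  have "wp (For 4 5 3 (For 6 7 3 (Add 10 10 10))) (r(2 := 1, 20 := 0, 3 := x, 10 := 150)) m
     (\<lambda>t r' m'. t \<le> x * ((x * (1 + 3) + 3) + 3) + 3 \<and> J (x * x) r' m')"
  proof (rule wp_For[where I = "\<lambda>y. J (y * x)"])
    fix y r1 m1
    assume "J (y * x) r1 m1" "r1 4 = y"
    from inner[OF this] show "wp (For 6 7 3 (Add 10 10 10)) r1 m1
      (\<lambda>t r' m'. t \<le> x * (1 + 3) + 3 \<and> r' 4 = y \<and> r' 3 = x \<and> r' 2 = 1 \<and>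
        J (Suc y * x) (r'(4 := Suc y, 5 := x - Suc y)) m')"
      by (rule wp_mono) (auto simp: J_def algebra_simps)
  qed (auto simp: J_def)
  then have "wp bound_prog r m (\<lambda>t r' m'. t \<le> x * (x * 4 + 6) + 8 \<and> r' 0 = 150 * 2 ^ (x * x))"
    unfolding bound_prog_def using m by simp (erule wp_mono, auto simp: J_def algebra_simps)
  then show "outputs_within bound_prog [x] (150 * 2 ^ (x * x)) (x * (x * 4 + 6) + 8)"
    unfolding outputs_within_def wp_def r_def m_def by auto
qed

text \<open>Every entry contributes at least its separator bit, so the size is at least the list
  length.\<close>

lemma order_le_input_size: "order x \<le> input_size (ssp_encode x)"
proof -
  have "length w \<le> input_size w" for w
    by (induction w) (auto simp: input_size_def)
  then have "5 + order x * order x \<le> input_size (ssp_encode x)"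
    using length_ssp_encode[of x] by metis
  moreover have "order x \<le> order x * order x" by (cases "order x") auto
  ultimately show ?thesis by linarith
qed

theorem theorem3:
  shows "(\<exists>p C c. \<forall>x\<in>ssp_instances.
            decides_within p (ssp_encode x) (ssp_yes x)
              (C * (len_bound x + nbhd_bound x) ^ len_bound x * order x ^ c))
       \<and> fixed_parameter_tractable ssp_instances ssp_encode ssp_yes
            (\<lambda>x. len_bound x + nbhd_bound x)"
proof
  show "\<exists>p C c. \<forall>x\<in>ssp_instances. decides_within p (ssp_encode x) (ssp_yes x)
      (C * (len_bound x + nbhd_bound x) ^ len_bound x * order x ^ c)"
    using main_prog_correct by blast
next
  have mono: "decides_within p w Y c" if "decides_within p w Y b" "b \<le> c" for p w Y b c
    using that order_trans unfolding decides_within_def outputs_within_def by blast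
  \<comment> \<open>The power becomes the computable bound in the parameter, and the order is
    replaced by the larger input size.\<close>
  have "150 * (len_bound x + nbhd_bound x) ^ len_bound x * order x ^ 2 \<le>
      150 * 2 ^ ((len_bound x + nbhd_bound x) * (len_bound x + nbhd_bound x)) *
      input_size (ssp_encode x) ^ 2" (is "150 * ?K ^ _ * _ \<le> _")
    if "x \<in> ssp_instances" for x
  proof -
    have "?K ^ len_bound x \<le> (2 ^ ?K) ^ len_bound x"
      by (intro power_mono) (use less_exp[of ?K] in auto)
    also have "\<dots> \<le> (2 ^ ?K) ^ ?K"
      by (intro power_increasing) auto
    also have "\<dots> = 2 ^ (?K * ?K)" by (simp add: power_mult)
    finally show ?thesis
      by (intro mult_mono power_mono order_le_input_size) auto
  qed
  then show "fixed_parameter_tractable ssp_instances ssp_encode ssp_yes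
      (\<lambda>x. len_bound x + nbhd_bound x)"
    unfolding fixed_parameter_tractable_def
    using main_prog_correct mono computable_bound
    by (intro exI[of _ main_prog] exI[of _ "\<lambda>x. 150 * 2 ^ (x * x)"] exI[of _ 2]) blast
qed

end
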